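(* Let $(X,\Sigma,\mu)$ be a complete $\sigma$-finite measure space, $\mathcal{A}\subseteq\Sigma$ a sub-$\sigma$-algebra such that $\mu|_{\mathcal{A}}$ is $\sigma$-finite, $E=E^{\mathcal{A}}$ the associated conditional expectation operator, and $u,w\in\mathcal{D}(E)$. The operator $T=M_wEM_u:L^2(\Sigma)\to L^2(\Sigma)$, $T(f)=wE(uf)$, is bounded if and only if $(E(|w|^2))^{1/2}(E(|u|^2))^{1/2}\in L^\infty(\mathcal{A})$, and in this case $$\|T\|=\big\|(E(|w|^2))^{1/2}(E(|u|^2))^{1/2}\big\|_\infty .$$
   Context: Functions are complex valued and identified when equal $\mu$-a.e.; relations between functions or sets hold up to $\mu$-null sets. $L^p(\Sigma)=L^p(X,\Sigma,\mu)$ and $L^p(\mathcal{A})=L^p(X,\mathcal{A},\mu|_{\mathcal{A}})$. $L^0(\Sigma)$ (resp. $L^0(\mathcal{A})$) is the space of a.e. finite valued $\Sigma$-measurable (resp. $\mathcal{A}$-measurable) functions. For measurable $f\ge 0$, $E(f)$ is the a.e. unique $\mathcal{A}$-measurable $[0,\infty]$-valued function with $\int_A f\,d\mu=\int_A E(f)\,d\mu$ for all $A\in\mathcal{A}$; it is extended linearly to all $f\in L^0(\Sigma)$, with $E(f)$ defined on the set where $E(|f|)<\infty$. $\mathcal{D}(E)=\{g\in L^0(\Sigma): E(|g|)\in L^0(\mathcal{A})\}$. $M_g$ denotes multiplication by $g$. Convention: a product one of whose factors is $0$ at a point is $0$ there, even if other factors are infinite or undefined at that point (note that $w=0$ a.e.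 on $\{E(|w|^2)=0\}$). "$T$ is bounded on $L^2(\Sigma)$" means that for every $f\in L^2(\Sigma)$ one has $E(|uf|)<\infty$ a.e. on $\{E(|w|^2)>0\}$, $wE(uf)\in L^2(\Sigma)$ (the function $wE(uf)$ being set equal to $0$ on $\{E(|w|^2)=0\}$), and there is a constant $C$ with $\|wE(uf)\|_2\le C\|f\|_2$ for all such $f$; $\|T\|$ is the least such $C$. *)

theory Defs
  imports "HOL-Probability.Conditional_Expectation" "HOL-Probability.Essential_Supremum"
begin

text \<open>
  A sub-sigma-algebra is represented, as in \<^theory>\<open>HOL-Probability.Conditional_Expectation\<close>, by a
  measure \<open>F\<close> with \<^term>\<open>subalgebra M F\<close>; only its sigma-algebra matters, and the restriction
  of the measure is \<^term>\<open>restr_to_subalg M F\<close>. For \<open>f \<ge> 0\<close> the function \<open>E(f)\<close> is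
  \<^const>\<open>nn_cond_exp\<close>, with values in \<open>[0,\<infinity>]\<close>.
  Functions identified almost everywhere are represented by measurable functions.
\<close>

definition L2 :: "'a measure \<Rightarrow> ('a \<Rightarrow> complex) set" where
  "L2 M = {f. f \<in> borel_measurable M \<and> integrable M (\<lambda>x. (cmod (f x))\<^sup>2)}"

definition L2_norm :: "'a measure \<Rightarrow> ('a \<Rightarrow> complex) \<Rightarrow> real" where
  "L2_norm M f = sqrt (\<integral>x. (cmod (f x))\<^sup>2 \<partial>M)"

text \<open>
  \<open>L\<^sup>\<infinity>\<close> membership and norm for \<open>[0,\<infinity>]\<close>-valued functions; a finite essential supremum forces
  the function to be finite almost everywhere. Taking the essential supremum in \<^typ>\<open>ennreal\<close>
  makes the norm \<open>0\<close> on a space of measure zero.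
\<close>

definition Linfty :: "'a measure \<Rightarrow> ('a \<Rightarrow> ennreal) set" where
  "Linfty M = {h. h \<in> borel_measurable M \<and> esssup M h < \<infinity>}"

definition Linfty_norm :: "'a measure \<Rightarrow> ('a \<Rightarrow> ennreal) \<Rightarrow> ennreal" where
  "Linfty_norm M h = esssup M h"

definition ennsqrt :: "ennreal \<Rightarrow> ennreal" where
  "ennsqrt a = (if a = \<infinity> then \<infinity> else ennreal (sqrt (enn2real a)))"

text \<open>
  The linear extension of \<open>E\<close> to complex functions. It is meaningful only at the points where
  \<open>E(|f|) < \<infinity>\<close>; elsewhere the value is an artefact of the total function
  \<^const>\<open>real_cond_exp\<close>.
\<close>

definition complex_cond_exp :: "'a measure \<Rightarrow> 'a measure \<Rightarrow> ('a \<Rightarrow> complex) \<Rightarrow> 'a \<Rightarrow> complex" where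
  "complex_cond_exp M F f x =
     Complex (real_cond_exp M F (\<lambda>y. Re (f y)) x) (real_cond_exp M F (\<lambda>y. Im (f y)) x)"

definition cond_exp_dom :: "'a measure \<Rightarrow> 'a measure \<Rightarrow> ('a \<Rightarrow> complex) set" where
  "cond_exp_dom M F =
     {g. g \<in> borel_measurable M \<and> (AE x in M. nn_cond_exp M F (\<lambda>y. ennreal (cmod (g y))) x < \<infinity>)}"

definition cond_exp_sq :: "'a measure \<Rightarrow> 'a measure \<Rightarrow> ('a \<Rightarrow> complex) \<Rightarrow> 'a \<Rightarrow> ennreal" where
  "cond_exp_sq M F g = nn_cond_exp M F (\<lambda>y. ennreal ((cmod (g y))\<^sup>2))"

text \<open>
  \<open>T = M\<^sub>w E M\<^sub>u\<close>, that is \<open>T f = w E(u f)\<close>, set equal to \<open>0\<close> where \<open>E(|w|\<^sup>2) = 0\<close>.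
\<close>

definition wce_op ::
  "'a measure \<Rightarrow> 'a measure \<Rightarrow> ('a \<Rightarrow> complex) \<Rightarrow> ('a \<Rightarrow> complex) \<Rightarrow> ('a \<Rightarrow> complex) \<Rightarrow> 'a \<Rightarrow> complex" where
  "wce_op M F w u f x =
     (if cond_exp_sq M F w x = 0 then 0 else w x * complex_cond_exp M F (\<lambda>y. u y * f y) x)"

definition wce_bound ::
  "'a measure \<Rightarrow> 'a measure \<Rightarrow> ('a \<Rightarrow> complex) \<Rightarrow> ('a \<Rightarrow> complex) \<Rightarrow> real \<Rightarrow> bool" where
  "wce_bound M F w u C \<longleftrightarrow>
     0 \<le> C \<and> (\<forall>f\<in>L2 M. L2_norm M (wce_op M F w u f) \<le> C * L2_norm M f)"

text \<open>
  The first clause says that \<open>T f\<close> is well defined. The membership in \<^const>\<open>L2\<close> is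
  stated separately because \<^const>\<open>L2_norm\<close> is not meaningful outside \<open>L\<^sup>2\<close>.
\<close>

definition wce_bounded ::
  "'a measure \<Rightarrow> 'a measure \<Rightarrow> ('a \<Rightarrow> complex) \<Rightarrow> ('a \<Rightarrow> complex) \<Rightarrow> bool" where
  "wce_bounded M F w u \<longleftrightarrow>
     (\<forall>f\<in>L2 M.
        (AE x in M. cond_exp_sq M F w x > 0 \<longrightarrow>
           nn_cond_exp M F (\<lambda>y. ennreal (cmod (u y * f y))) x < \<infinity>) \<and>
        wce_op M F w u f \<in> L2 M) \<and>
     (\<exists>C. wce_bound M F w u C)"

definition wce_norm ::
  "'a measure \<Rightarrow> 'a measure \<Rightarrow> ('a \<Rightarrow> complex) \<Rightarrow> ('a \<Rightarrow> complex) \<Rightarrow> real" where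
  "wce_norm M F w u = (LEAST C. wce_bound M F w u C)"

end

theory Submission
  imports Defs
begin

text \<open>
  Pulling the \<open>F\<close>-measurable factor \<open>|E(uf)|\<^sup>2\<close> out of the conditional expectation gives
  \<open>\<parallel>T f\<parallel>\<^sup>2 = \<integral> E(|w|\<^sup>2) |E(uf)|\<^sup>2\<close>. The upper bound on \<open>\<parallel>T\<parallel>\<close> then follows from the conditional
  Cauchy-Schwarz inequality \<open>|E(uf)|\<^sup>2 \<le> E(|u|\<^sup>2) E(|f|\<^sup>2)\<close>. Conversely, testing a bound \<open>C\<close> on
  \<open>f = cnj u\<close>, cut off to \<open>|u| \<le> m\<close> and to an \<open>F\<close>-set of finite measure, yields
  \<open>E(|w|\<^sup>2) U\<^sub>m \<le> C\<^sup>2\<close> almost everywhere for the conditional expectation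
  \<open>U\<^sub>m\<close> of the cut-off \<open>|u|\<^sup>2\<close>, and \<open>U\<^sub>m\<close> increases to \<open>E(|u|\<^sup>2)\<close>.
\<close>

section \<open>Real quadratics, measurability, and square roots in \<open>ennreal\<close>\<close>

text \<open>Closedness extends the inequality from rational to real \<open>t\<close>, and the vertex
  of the parabola then gives the claim. Only rational \<open>t\<close> are assumed because in the
  conditional Cauchy-Schwarz inequality each \<open>t\<close> brings its own null set.\<close>

lemma discriminant_le_of_rational_bound:
  fixes a b c :: real
  assumes "0 \<le> a" "\<And>t. t \<in> \<rat> \<Longrightarrow> 2 * t * c \<le> t\<^sup>2 * a + b"
  shows "c\<^sup>2 \<le> a * b"
proof -
  have "closed {t. 2 * t * c \<le> t\<^sup>2 * a + b}"
    by (intro closed_Collect_le continuous_intros)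
  moreover have "\<rat> \<subseteq> {t. 2 * t * c \<le> t\<^sup>2 * a + b}"
    using assms(2) by blast
  ultimately have "closure \<rat> \<subseteq> {t. 2 * t * c \<le> t\<^sup>2 * a + b}"
    by (rule closure_minimal[rotated])
  then have *: "2 * t * c \<le> t\<^sup>2 * a + b" for t
    by (auto simp: Rats_closure_real)
  show ?thesis
  proof (cases "a = 0")
    case True
    have "c = 0"
    proof (rule ccontr)
      assume "c \<noteq> 0"
      \<comment> \<open>With \<open>a = 0\<close> this value of \<open>t\<close> turns the
        inequality into \<open>b + 1 \<le> b\<close>.\<close>
      then show False using *[of "(b + 1) / (2 * c)"] True by simp
    qed
    then show ?thesis using True by simp
  next
    case False
    \<comment> \<open>\<open>c / a\<close> minimises
      \<open>t\<^sup>2 * a - 2 * t * c + b\<close>.\<close>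
    have "2 * (c / a) * c \<le> (c / a)\<^sup>2 * a + b" by (rule *)
    then have "c\<^sup>2 / a \<le> b" using False by (simp add: power2_eq_square)
    then show ?thesis using False assms(1) by (simp add: field_simps)
  qed
qed

lemma borel_measurable_Complex [measurable (raw)]:
  assumes [measurable]: "f \<in> borel_measurable M" "g \<in> borel_measurable M"
  shows "(\<lambda>x. Complex (f x) (g x)) \<in> borel_measurable M"
  unfolding Complex_eq by measurable

lemma borel_measurable_cnj [measurable (raw)]:
  assumes "f \<in> borel_measurable M"
  shows "(\<lambda>x. cnj (f x)) \<in> borel_measurable M"
  by (rule borel_measurable_continuous_on[OF _ assms]) (intro continuous_intros)

lemma borel_measurable_complex_cond_exp [measurable]:
  "complex_cond_exp M F f \<in> borel_measurable F"
  "complex_cond_exp M F f \<in> borel_measurable M"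
  unfolding complex_cond_exp_def by measurable

lemma borel_measurable_cond_exp_sq [measurable]:
  "cond_exp_sq M F f \<in> borel_measurable F"
  "cond_exp_sq M F f \<in> borel_measurable M"
  unfolding cond_exp_sq_def by measurable

lemma borel_measurable_ennsqrt [measurable]: "ennsqrt \<in> borel_measurable borel"
  unfolding ennsqrt_def by measurable

text \<open>Infinite factors cause no discrepancy: in both products, \<infinity> times
  \<open>0\<close> is \<open>0\<close> and \<infinity> times anything positive is \<infinity>. For
  finite factors this is monotonicity of the square root.\<close>

lemma ennsqrt_mult_le_iff:
  assumes "0 \<le> C"
  shows "ennsqrt a * ennsqrt b \<le> ennreal C \<longleftrightarrow> a * b \<le> ennreal (C\<^sup>2)"
proof (cases a; cases b)
  fix r s assume H: "a = ennreal r" "0 \<le> r" "b = ennreal s" "0 \<le> s"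
  have "sqrt r * sqrt s \<le> C \<longleftrightarrow> r * s \<le> C\<^sup>2"
    using assms H by (metis real_sqrt_le_iff real_sqrt_mult real_sqrt_unique)
  then show ?thesis
    using H assms by (simp add: ennsqrt_def ennreal_mult[symmetric])
qed (auto simp: ennsqrt_def ennreal_mult_top ennreal_top_mult top_unique)

section \<open>The \<open>L2\<close> norm through integrals in \<open>ennreal\<close>\<close>

lemma L2_norm_nonneg: "0 \<le> L2_norm M f"
  by (simp add: L2_norm_def)

lemma ennreal_L2_norm_sq:
  assumes "f \<in> L2 M"
  shows "ennreal ((L2_norm M f)\<^sup>2) = (\<integral>\<^sup>+x. ennreal ((cmod (f x))\<^sup>2) \<partial>M)"
  using assms unfolding L2_def L2_norm_def by (simp add: nn_integral_eq_integral)

lemma L2_iff: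
  "f \<in> L2 M \<longleftrightarrow> f \<in> borel_measurable M \<and> (\<integral>\<^sup>+x. ennreal ((cmod (f x))\<^sup>2) \<partial>M) < \<infinity>"
  unfolding L2_def by (auto simp: integrable_iff_bounded)

text \<open>This moves norm bounds into \<open>ennreal\<close>, where conditional expectations and
  integrals may be manipulated without integrability side conditions.\<close>

lemma L2_norm_le_iff:
  assumes "f \<in> L2 M" "g \<in> L2 M" "0 \<le> C"
  shows "L2_norm M f \<le> C * L2_norm M g \<longleftrightarrow>
    (\<integral>\<^sup>+x. ennreal ((cmod (f x))\<^sup>2) \<partial>M) \<le> ennreal (C\<^sup>2) * (\<integral>\<^sup>+x. ennreal ((cmod (g x))\<^sup>2) \<partial>M)"
proof -
  have "L2_norm M f \<le> C * L2_norm M g \<longleftrightarrow> (L2_norm M f)\<^sup>2 \<le> C\<^sup>2 * (L2_norm M g)\<^sup>2"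
    using assms(3) L2_norm_nonneg[of M f] L2_norm_nonneg[of M g]
    by (metis mult_nonneg_nonneg power_mult_distrib abs_le_square_iff abs_of_nonneg)
  then show ?thesis
    using assms(1,2) by (simp add: ennreal_L2_norm_sq[symmetric] ennreal_mult[symmetric])
qed

section \<open>Localisation to sets of \<open>F\<close> and conditional monotone convergence\<close>

context sigma_finite_subalgebra
begin

lemma measurable_F_imp_M: "f \<in> measurable F N \<Longrightarrow> f \<in> measurable M N"
  by (rule measurable_from_subalg[OF subalg])

lemma sets_F_imp_M: "A \<in> sets F \<Longrightarrow> A \<in> sets M"
  using subalg by (auto simp: subalgebra_def)

text \<open>The covering sets must lie in \<open>F\<close>, so that their indicators can be pulled
  out of conditional expectations; hence they are taken from the sigma-finite restricted
  measure.\<close>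

lemma finite_measure_cover:
  obtains S :: "nat \<Rightarrow> 'a set" where
    "\<And>n. S n \<in> sets F" "\<And>n. emeasure M (S n) < \<infinity>" "(\<Union>n. S n) = space M"
proof -
  obtain S :: "nat \<Rightarrow> 'a set" where S: "range S \<subseteq> sets (restr_to_subalg M F)"
    "(\<Union>n. S n) = space (restr_to_subalg M F)" "\<And>n. emeasure (restr_to_subalg M F) (S n) \<noteq> \<infinity>"
    by (rule sigma_finite_measure.sigma_finite[OF sigma_fin_subalg]) blast
  have F: "S n \<in> sets F" for n
    using S(1) by (auto simp: sets_restr_to_subalg[OF subalg])
  show ?thesis
    using that[of S] F S(2,3)
    by (simp add: space_restr_to_subalg emeasure_restr_to_subalg[OF subalg] less_top)
qed

lemma nn_cond_exp_indicator:
  assumes [measurable]: "A \<in> sets F" "g \<in> borel_measurable M"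
  shows "AE x in M. nn_cond_exp M F (\<lambda>x. indicator A x * g x) x = indicator A x * nn_cond_exp M F g x"
  by (rule AE_symmetric, rule nn_cond_exp_prod) auto

text \<open>No integrability is assumed: \<open>real_cond_exp\<close> is built from the nonnegative
  conditional expectations of the positive and negative parts, and the indicator leaves each of them
  separately.\<close>

lemma real_cond_exp_indicator:
  assumes [measurable]: "A \<in> sets F" "f \<in> borel_measurable M"
  shows "AE x in M. real_cond_exp M F (\<lambda>x. indicator A x * f x) x = indicator A x * real_cond_exp M F f x"
proof -
  have eq: "ennreal (indicator A x * r) = indicator A x * ennreal r"
           "ennreal (- (indicator A x * r)) = indicator A x * ennreal (- r)" for x r
    by (auto simp: indicator_def)
  have "AE x in M. nn_cond_exp M F (\<lambda>x. indicator A x * ennreal (f x)) x = indicator A x * nn_cond_exp M F (\<lambda>x. ennreal (f x)) x"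
       "AE x in M. nn_cond_exp M F (\<lambda>x. indicator A x * ennreal (- f x)) x = indicator A x * nn_cond_exp M F (\<lambda>x. ennreal (- f x)) x"
    by (rule nn_cond_exp_indicator; measurable)+
  then show ?thesis
    unfolding real_cond_exp_def eq by eventually_elim (auto simp: indicator_def)
qed

lemma real_cond_exp_eq_enn2real:
  assumes [measurable]: "f \<in> borel_measurable M" and "\<And>x. 0 \<le> f x"
  shows "AE x in M. real_cond_exp M F f x = enn2real (nn_cond_exp M F (\<lambda>x. ennreal (f x)) x)"
proof -
  have "(\<lambda>x. ennreal (- f x)) = (\<lambda>x. 0)"
    using assms(2) by (simp add: ennreal_neg)
  moreover have "AE x in M. 0 = nn_cond_exp M F (\<lambda>x. 0) x"
    by (rule nn_cond_exp_F_meas) auto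
  ultimately show ?thesis
    unfolding real_cond_exp_def by (auto elim: eventually_mono)
qed

text \<open>Conditional monotone convergence. Over each set of \<open>F\<close>, monotone
  convergence is applied once to \<open>f i\<close> and once to its conditional expectation; the
  latter increases only almost everywhere, so the almost-everywhere version is used.\<close>

lemma nn_cond_exp_SUP:
  fixes f :: "nat \<Rightarrow> 'a \<Rightarrow> ennreal"
  assumes [measurable]: "\<And>i. f i \<in> borel_measurable M" and mono: "\<And>x. incseq (\<lambda>i. f i x)"
  shows "AE x in M. (SUP i. nn_cond_exp M F (f i) x) = nn_cond_exp M F (\<lambda>x. SUP i. f i x) x"
proof (rule nn_cond_exp_charact)
  fix A assume [measurable]: "A \<in> sets F"
  then have [measurable]: "A \<in> sets M" by (rule sets_F_imp_M)
  have "(\<integral>\<^sup>+x\<in>A. (SUP i. f i x) \<partial>M) = (\<integral>\<^sup>+x. (SUP i. indicator A x * f i x) \<partial>M)"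
    by (simp add: SUP_mult_left_ennreal mult.commute[of _ "indicator A _"])
  also have "\<dots> = (SUP i. \<integral>\<^sup>+x. indicator A x * f i x \<partial>M)"
    by (rule nn_integral_monotone_convergence_SUP_AE)
       (auto intro!: mult_left_mono incseq_SucD[OF mono])
  also have "\<dots> = (SUP i. \<integral>\<^sup>+x. indicator A x * nn_cond_exp M F (f i) x \<partial>M)"
    by (simp add: nn_cond_exp_intg)
  also have "\<dots> = (\<integral>\<^sup>+x. (SUP i. indicator A x * nn_cond_exp M F (f i) x) \<partial>M)"
  proof (rule nn_integral_monotone_convergence_SUP_AE[symmetric])
    fix i
    have "AE x in M. nn_cond_exp M F (f i) x \<le> nn_cond_exp M F (f (Suc i)) x"
      by (rule nn_cond_exp_mono) (auto intro: incseq_SucD[OF mono])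
    then show "AE x in M. indicator A x * nn_cond_exp M F (f i) x \<le> indicator A x * nn_cond_exp M F (f (Suc i)) x"
      by eventually_elim (rule mult_left_mono, auto)
  qed auto
  also have "\<dots> = (\<integral>\<^sup>+x\<in>A. (SUP i. nn_cond_exp M F (f i) x) \<partial>M)"
    by (simp add: SUP_mult_left_ennreal mult.commute[of _ "indicator A _"])
  finally show "(\<integral>\<^sup>+x\<in>A. (SUP i. f i x) \<partial>M) = (\<integral>\<^sup>+x\<in>A. (SUP i. nn_cond_exp M F (f i) x) \<partial>M)" .
qed auto

section \<open>The conditional Cauchy-Schwarz inequality\<close>

text \<open>The source is \<open>(t * f - g)\<^sup>2 \<ge> 0\<close>, arranged without subtraction
  so that it can be conditioned in \<open>ennreal\<close>. This needs \<open>t \<ge> 0\<close>; for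
  negative \<open>t\<close> the inequality is clear from the signs. The discriminant bound
  finishes.\<close>

lemma nn_cond_exp_Cauchy_Schwarz:
  fixes f g :: "'a \<Rightarrow> real"
  assumes [measurable]: "f \<in> borel_measurable M" "g \<in> borel_measurable M"
    and nonneg: "\<And>x. 0 \<le> f x" "\<And>x. 0 \<le> g x"
  shows "AE x in M. nn_cond_exp M F (\<lambda>x. ennreal ((f x)\<^sup>2)) x < \<infinity> \<longrightarrow>
      nn_cond_exp M F (\<lambda>x. ennreal ((g x)\<^sup>2)) x < \<infinity> \<longrightarrow>
      (nn_cond_exp M F (\<lambda>x. ennreal (f x * g x)) x)\<^sup>2
        \<le> nn_cond_exp M F (\<lambda>x. ennreal ((f x)\<^sup>2)) x * nn_cond_exp M F (\<lambda>x. ennreal ((g x)\<^sup>2)) x"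
proof -
  let ?E = "nn_cond_exp M F"
  let ?a = "?E (\<lambda>x. ennreal ((f x)\<^sup>2))" and ?b = "?E (\<lambda>x. ennreal ((g x)\<^sup>2))"
    and ?c = "?E (\<lambda>x. ennreal (f x * g x))"
  have "AE x in M. ennreal (2 * t) * ?c x \<le> ennreal (t\<^sup>2) * ?a x + ?b x" if "0 \<le> t" for t :: real
  proof -
    have "ennreal (2 * t) * ennreal (f x * g x) \<le> ennreal (t\<^sup>2) * ennreal ((f x)\<^sup>2) + ennreal ((g x)\<^sup>2)" for x
    proof -
      have "2 * t * (f x * g x) \<le> t\<^sup>2 * (f x)\<^sup>2 + (g x)\<^sup>2"
        using sum_squares_bound[of "t * f x" "g x"] by (simp add: power_mult_distrib algebra_simps)
      then show ?thesis
        using that nonneg by (simp add: ennreal_mult[symmetric] ennreal_plus[symmetric] del: ennreal_plus)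
    qed
    then have "AE x in M. ?E (\<lambda>x. ennreal (2 * t) * ennreal (f x * g x)) x
        \<le> ?E (\<lambda>x. ennreal (t\<^sup>2) * ennreal ((f x)\<^sup>2) + ennreal ((g x)\<^sup>2)) x"
      by (intro nn_cond_exp_mono) auto
    moreover have "AE x in M. ennreal (2 * t) * ?c x = ?E (\<lambda>x. ennreal (2 * t) * ennreal (f x * g x)) x"
      by (rule nn_cond_exp_prod) auto
    moreover have "AE x in M. ennreal (t\<^sup>2) * ?a x = ?E (\<lambda>x. ennreal (t\<^sup>2) * ennreal ((f x)\<^sup>2)) x"
      by (rule nn_cond_exp_prod) auto
    moreover have "AE x in M. ?E (\<lambda>x. ennreal (t\<^sup>2) * ennreal ((f x)\<^sup>2)) x + ?b x
        = ?E (\<lambda>x. ennreal (t\<^sup>2) * ennreal ((f x)\<^sup>2) + ennreal ((g x)\<^sup>2)) x"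
      by (rule nn_cond_exp_sum) auto
    ultimately show ?thesis by eventually_elim auto
  qed
  \<comment> \<open>Countably many \<open>t\<close> leave a single null set outside which all the
    inequalities hold.\<close>
  then have "AE x in M. \<forall>t\<in>\<rat> \<inter> {0..}. ennreal (2 * t) * ?c x \<le> ennreal (t\<^sup>2) * ?a x + ?b x"
    by (intro AE_ball_countable[THEN iffD2] countable_Int1 countable_rat) auto
  then show ?thesis
  proof eventually_elim
    case (elim x)
    show ?case
    proof (intro impI)
      assume fin: "?a x < \<infinity>" "?b x < \<infinity>"
      \<comment> \<open>The instance \<open>t = 1\<close> shows that \<open>?c x\<close> is finite,
        which permits passing to real numbers.\<close>
      have "2 * ?c x \<le> ?a x + ?b x"
        using elim[THEN bspec, of 1] by simp
      then have "?c x < \<infinity>"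
        using fin by (cases "?c x") (auto simp: top_unique)
      obtain a b c where abc: "?a x = ennreal a" "?b x = ennreal b" "?c x = ennreal c"
          "0 \<le> a" "0 \<le> b" "0 \<le> c"
        using that[of "enn2real (?a x)" "enn2real (?b x)" "enn2real (?c x)"] fin \<open>?c x < \<infinity>\<close>
        by simp
      have "c\<^sup>2 \<le> a * b"
      proof (rule discriminant_le_of_rational_bound)
        fix t :: real assume "t \<in> \<rat>"
        show "2 * t * c \<le> t\<^sup>2 * a + b"
        proof (cases "0 \<le> t")
          case True
          then have "ennreal (2 * t) * ennreal c \<le> ennreal (t\<^sup>2) * ennreal a + ennreal b"
            using elim \<open>t \<in> \<rat>\<close> abc by auto
          then show ?thesis
            using abc True by (simp add: ennreal_mult[symmetric] ennreal_plus[symmetric] del: ennreal_plus)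
        next
          case False
          then have "2 * t * c \<le> 0" using abc by (simp add: mult_nonpos_nonneg)
          also have "0 \<le> t\<^sup>2 * a + b" using abc by simp
          finally show ?thesis .
        qed
      qed (rule abc)
      then show "(?c x)\<^sup>2 \<le> ?a x * ?b x"
        using abc by (simp add: ennreal_power ennreal_mult[symmetric])
    qed
  qed
qed

section \<open>The modulus of a complex conditional expectation\<close>

text \<open>Rotate by the phase: with \<open>z\<close> measurable in \<open>F\<close> and
  \<open>z E(g) = |E(g)|\<close>, one has
  \<open>|E(g)| = Re E(z g) = E(Re (z g)) \<le> E(|g|)\<close>. As \<open>real_cond_exp\<close> acts
  on real functions, \<open>Re (z g)\<close> is expanded into its two products.\<close>

lemma norm_complex_cond_exp_le_integrable:
  assumes int: "integrable M g"
  shows "AE x in M. ennreal (cmod (complex_cond_exp M F g x)) \<le> nn_cond_exp M F (\<lambda>y. ennreal (cmod (g y))) x"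
proof -
  have [measurable]: "g \<in> borel_measurable M" using int by auto
  \<comment> \<open>Division by zero yields \<open>0\<close>, so \<open>z\<close> vanishes where the
    conditional expectation does and \<open>cmod (z x) \<le> 1\<close> holds everywhere.\<close>
  define z where "z x = cnj (complex_cond_exp M F g x) / complex_of_real (cmod (complex_cond_exp M F g x))" for x
  have [measurable]: "z \<in> borel_measurable F"
    unfolding z_def by measurable
  have [measurable]: "z \<in> borel_measurable M" by (rule measurable_F_imp_M) measurable
  have z_le: "cmod (z x) \<le> 1" for x by (simp add: z_def norm_divide)
  have z_bd: "\<bar>Re (z x)\<bar> \<le> 1" "\<bar>Im (z x)\<bar> \<le> 1" for x
    using z_le[of x] abs_Re_le_cmod[of "z x"] abs_Im_le_cmod[of "z x"] by linarith+
  have i1: "integrable M (\<lambda>x. Re (z x) * Re (g x))"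
    by (rule Bochner_Integration.integrable_bound[OF int])
       (auto simp: abs_mult intro!: AE_I2 order_trans[OF mult_mono[OF z_bd(1) abs_Re_le_cmod]])
  have i2: "integrable M (\<lambda>x. - Im (z x) * Im (g x))"
    by (rule Bochner_Integration.integrable_bound[OF int])
       (auto simp: abs_mult intro!: AE_I2 order_trans[OF mult_mono[OF z_bd(2) abs_Im_le_cmod]])
  have "AE x in M. real_cond_exp M F (\<lambda>x. Re (z x) * Re (g x)) x = Re (z x) * real_cond_exp M F (\<lambda>x. Re (g x)) x"
    by (rule real_cond_exp_mult) (auto intro: i1)
  moreover have "AE x in M. real_cond_exp M F (\<lambda>x. - Im (z x) * Im (g x)) x = - Im (z x) * real_cond_exp M F (\<lambda>x. Im (g x)) x"
    by (rule real_cond_exp_mult) (use i2 in auto)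
  moreover have "AE x in M. real_cond_exp M F (\<lambda>x. Re (z x) * Re (g x) + - Im (z x) * Im (g x)) x
      = real_cond_exp M F (\<lambda>x. Re (z x) * Re (g x)) x + real_cond_exp M F (\<lambda>x. - Im (z x) * Im (g x)) x"
    by (rule real_cond_exp_add[OF i1 i2])
  moreover have "AE x in M. real_cond_exp M F (\<lambda>x. Re (z x) * Re (g x) + - Im (z x) * Im (g x)) x
      \<le> real_cond_exp M F (\<lambda>x. cmod (g x)) x"
  proof (rule real_cond_exp_mono[OF AE_I2])
    fix x
    have "Re (z x) * Re (g x) + - Im (z x) * Im (g x) = Re (z x * g x)" by simp
    also have "\<dots> \<le> cmod (z x * g x)" by (rule complex_Re_le_cmod)
    also have "\<dots> \<le> cmod (g x)" using mult_right_mono[OF z_le norm_ge_zero, of x "g x"] by (simp add: norm_mult)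
    finally show "Re (z x) * Re (g x) + - Im (z x) * Im (g x) \<le> cmod (g x)" .
  qed (use i1 i2 int in auto)
  moreover have "AE x in M. real_cond_exp M F (\<lambda>x. cmod (g x)) x = enn2real (nn_cond_exp M F (\<lambda>x. ennreal (cmod (g x))) x)"
    by (rule real_cond_exp_eq_enn2real) auto
  ultimately show ?thesis
  proof eventually_elim
    case (elim x)
    let ?h = "complex_cond_exp M F g x"
    have "z x * ?h = complex_of_real ((cmod ?h)\<^sup>2) / complex_of_real (cmod ?h)"
      unfolding complex_norm_square by (simp add: z_def mult.commute)
    also have "\<dots> = complex_of_real (cmod ?h)"
      by (simp add: power2_eq_square)
    finally have "cmod ?h = Re (z x * ?h)" by simp
    also have "\<dots> \<le> enn2real (nn_cond_exp M F (\<lambda>x. ennreal (cmod (g x))) x)"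
      using elim by (simp add: complex_cond_exp_def)
    finally show ?case
      by (metis ennreal_enn2real ennreal_leI le_cases not_less top_greatest ennreal_enn2real_if)
  qed
qed

text \<open>The product \<open>u f\<close> to which this is applied need not be integrable.
  Indicators of sets of \<open>F\<close> commute with conditional expectation, so the integrable
  case can be used piece by piece on countably many such sets.\<close>

lemma norm_complex_cond_exp_le:
  assumes [measurable]: "g \<in> borel_measurable M"
  shows "AE x in M. nn_cond_exp M F (\<lambda>y. ennreal (cmod (g y))) x < \<infinity> \<longrightarrow>
    ennreal (cmod (complex_cond_exp M F g x)) \<le> nn_cond_exp M F (\<lambda>y. ennreal (cmod (g y))) x"
proof -
  let ?e = "nn_cond_exp M F (\<lambda>y. ennreal (cmod (g y)))"
  obtain S :: "nat \<Rightarrow> 'a set" where S [measurable]: "\<And>n. S n \<in> sets F"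
    and S_fin: "\<And>n. emeasure M (S n) < \<infinity>" and S_un: "(\<Union>n. S n) = space M"
    using finite_measure_cover by blast
  \<comment> \<open>On each \<open>A n m\<close> the function \<open>g\<close> is integrable, and these sets exhaust \<open>E(|g|) < \<infinity>\<close>.\<close>
  define A where "A n m = {x \<in> S n. ?e x \<le> of_nat m}" for n m :: nat
  have A [measurable]: "A n m \<in> sets F" for n m unfolding A_def by measurable
  have AM [measurable]: "A n m \<in> sets M" for n m using A by (rule sets_F_imp_M)
  have "AE x in M. x \<in> A n m \<longrightarrow> ennreal (cmod (complex_cond_exp M F g x)) \<le> ?e x" for n m
  proof -
    define h where "h x = indicator (A n m) x * g x" for x
    have [measurable]: "h \<in> borel_measurable M" unfolding h_def by measurable
    have h_norm: "ennreal (cmod (h x)) = indicator (A n m) x * ennreal (cmod (g x))" for x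
      by (auto simp: h_def indicator_def)
    have h_Re_Im: "Re (h x) = indicator (A n m) x * Re (g x)" "Im (h x) = indicator (A n m) x * Im (g x)" for x
      by (auto simp: h_def indicator_def)
    have "(\<integral>\<^sup>+x. ennreal (cmod (h x)) \<partial>M) = (\<integral>\<^sup>+x. indicator (A n m) x * ?e x \<partial>M)"
      by (simp add: h_norm nn_cond_exp_intg)
    also have "\<dots> \<le> (\<integral>\<^sup>+x. of_nat m * indicator (S n) x \<partial>M)"
      by (intro nn_integral_mono) (auto simp: A_def indicator_def)
    also have "\<dots> < \<infinity>"
      using S_fin[of n] by (simp add: nn_integral_cmult_indicator sets_F_imp_M ennreal_mult_less_top of_nat_less_top)
    finally have "integrable M h" by (intro integrableI_bounded) auto
    then have "AE x in M. ennreal (cmod (complex_cond_exp M F h x)) \<le> nn_cond_exp M F (\<lambda>y. ennreal (cmod (h y))) x"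
      by (rule norm_complex_cond_exp_le_integrable)
    moreover have "AE x in M. nn_cond_exp M F (\<lambda>y. ennreal (cmod (h y))) x = indicator (A n m) x * ?e x"
      unfolding h_norm by (rule nn_cond_exp_indicator) auto
    moreover have "AE x in M. real_cond_exp M F (\<lambda>x. Re (h x)) x = indicator (A n m) x * real_cond_exp M F (\<lambda>x. Re (g x)) x"
      unfolding h_Re_Im by (rule real_cond_exp_indicator) auto
    moreover have "AE x in M. real_cond_exp M F (\<lambda>x. Im (h x)) x = indicator (A n m) x * real_cond_exp M F (\<lambda>x. Im (g x)) x"
      unfolding h_Re_Im by (rule real_cond_exp_indicator) auto
    ultimately show ?thesis
      by eventually_elim (auto simp: complex_cond_exp_def)
  qed
  then have "AE x in M. \<forall>n m. x \<in> A n m \<longrightarrow> ennreal (cmod (complex_cond_exp M F g x)) \<le> ?e x"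
    unfolding AE_all_countable by blast
  then show ?thesis
  proof (rule AE_mp, intro AE_I2 impI)
    fix x assume "x \<in> space M" and *: "\<forall>n m. x \<in> A n m \<longrightarrow> ennreal (cmod (complex_cond_exp M F g x)) \<le> ?e x"
      and "?e x < \<infinity>"
    obtain n where "x \<in> S n" using S_un \<open>x \<in> space M\<close> by blast
    moreover obtain m :: nat where "?e x \<le> of_nat m"
      using \<open>?e x < \<infinity>\<close> by (metis ennreal_Ex_less_of_nat infinity_ennreal_def less_imp_le)
    ultimately show "ennreal (cmod (complex_cond_exp M F g x)) \<le> ?e x"
      using * by (auto simp: A_def)
  qed
qed

section \<open>Upper and lower estimates for the operator\<close>

lemma borel_measurable_wce_op [measurable]:
  assumes [measurable]: "w \<in> borel_measurable M"
  shows "wce_op M F w u f \<in> borel_measurable M"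
  unfolding wce_op_def by measurable

lemma nn_integral_wce_op_sq:
  assumes [measurable]: "w \<in> borel_measurable M"
  shows "(\<integral>\<^sup>+x. ennreal ((cmod (wce_op M F w u f x))\<^sup>2) \<partial>M)
    = (\<integral>\<^sup>+x. cond_exp_sq M F w x * ennreal ((cmod (complex_cond_exp M F (\<lambda>y. u y * f y) x))\<^sup>2) \<partial>M)"
proof -
  let ?h = "complex_cond_exp M F (\<lambda>y. u y * f y)"
  \<comment> \<open>\<open>k\<close> builds in the convention that \<open>wce_op\<close> is
    \<open>0\<close> where \<open>E(|w|\<^sup>2) = 0\<close>. The convention disappears again at the
    end because there \<open>k\<close> is multiplied by \<open>E(|w|\<^sup>2)\<close>.\<close>
  define k where "k x = (if cond_exp_sq M F w x = 0 then 0 else ennreal ((cmod (?h x))\<^sup>2))" for x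
  have [measurable]: "k \<in> borel_measurable F" unfolding k_def by measurable
  have "(\<integral>\<^sup>+x. ennreal ((cmod (wce_op M F w u f x))\<^sup>2) \<partial>M) = (\<integral>\<^sup>+x. k x * ennreal ((cmod (w x))\<^sup>2) \<partial>M)"
    by (intro nn_integral_cong)
       (auto simp: wce_op_def k_def norm_mult power_mult_distrib ennreal_mult mult.commute)
  also have "\<dots> = (\<integral>\<^sup>+x. k x * cond_exp_sq M F w x \<partial>M)"
    unfolding cond_exp_sq_def by (rule nn_cond_exp_intg[symmetric]) auto
  also have "\<dots> = (\<integral>\<^sup>+x. cond_exp_sq M F w x * ennreal ((cmod (?h x))\<^sup>2) \<partial>M)"
    by (intro nn_integral_cong) (auto simp: k_def mult.commute)
  finally show ?thesis .
qed

text \<open>Pointwise, \<open>W |E(uf)|\<^sup>2 \<le> W E(|uf|)\<^sup>2 \<le> W U V \<le> C\<^sup>2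
  V\<close> where \<open>W > 0\<close>, and the left side is \<open>0\<close> elsewhere. The
  integral of \<open>V\<close> is that of \<open>|f|\<^sup>2\<close>.\<close>

lemma wce_op_bound:
  assumes [measurable]: "u \<in> borel_measurable M" "w \<in> borel_measurable M"
    and C: "0 \<le> C"
    and WU: "AE x in M. cond_exp_sq M F w x * cond_exp_sq M F u x \<le> ennreal (C\<^sup>2)"
    and f: "f \<in> L2 M"
  shows "AE x in M. cond_exp_sq M F w x > 0 \<longrightarrow> nn_cond_exp M F (\<lambda>y. ennreal (cmod (u y * f y))) x < \<infinity>"
    and "(\<integral>\<^sup>+x. ennreal ((cmod (wce_op M F w u f x))\<^sup>2) \<partial>M)
      \<le> ennreal (C\<^sup>2) * (\<integral>\<^sup>+x. ennreal ((cmod (f x))\<^sup>2) \<partial>M)"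
proof -
  let ?W = "cond_exp_sq M F w" and ?U = "cond_exp_sq M F u" and ?V = "cond_exp_sq M F f"
  let ?e = "nn_cond_exp M F (\<lambda>y. ennreal (cmod (u y * f y)))"
    and ?h = "complex_cond_exp M F (\<lambda>y. u y * f y)"
  have [measurable]: "f \<in> borel_measurable M" and f_fin: "(\<integral>\<^sup>+x. ennreal ((cmod (f x))\<^sup>2) \<partial>M) < \<infinity>"
    using f by (auto simp: L2_iff)
  have V_int: "(\<integral>\<^sup>+x. ?V x \<partial>M) = (\<integral>\<^sup>+x. ennreal ((cmod (f x))\<^sup>2) \<partial>M)"
    using nn_cond_exp_intg[of "\<lambda>_. 1" "\<lambda>x. ennreal ((cmod (f x))\<^sup>2)"] by (simp add: cond_exp_sq_def)
  then have "AE x in M. ?V x \<noteq> \<infinity>"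
    using f_fin by (intro nn_integral_PInf_AE) auto
  moreover have "AE x in M. ?U x < \<infinity> \<longrightarrow> ?V x < \<infinity> \<longrightarrow> (?e x)\<^sup>2 \<le> ?U x * ?V x"
    unfolding cond_exp_sq_def norm_mult by (rule nn_cond_exp_Cauchy_Schwarz) auto
  ultimately have CS: "AE x in M. ?W x > 0 \<longrightarrow> (?e x)\<^sup>2 \<le> ?U x * ?V x \<and> ?e x < \<infinity>"
    using WU
  proof eventually_elim
    case (elim x)
    show ?case
    proof
      assume "?W x > 0"
      \<comment> \<open>If \<open>?U x\<close> were infinite, its product with the positive
        \<open>?W x\<close> would exceed the finite bound.\<close>
      then have "?U x < \<infinity>"
        using elim(3) by (cases "?U x") (auto simp: ennreal_mult_top top_unique split: if_splits)
      then have "(?e x)\<^sup>2 \<le> ?U x * ?V x" "?U x * ?V x < \<infinity>"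
        using elim by (auto simp: ennreal_mult_less_top less_top)
      then show "(?e x)\<^sup>2 \<le> ?U x * ?V x \<and> ?e x < \<infinity>"
        by (cases "?e x") (auto simp: power2_eq_square ennreal_top_mult top_unique)
    qed
  qed
  then show "AE x in M. ?W x > 0 \<longrightarrow> ?e x < \<infinity>"
    by eventually_elim auto
  have "AE x in M. ?e x < \<infinity> \<longrightarrow> ennreal (cmod (?h x)) \<le> ?e x"
    by (rule norm_complex_cond_exp_le) measurable
  with CS WU have "AE x in M. ?W x * ennreal ((cmod (?h x))\<^sup>2) \<le> ennreal (C\<^sup>2) * ?V x"
  proof eventually_elim
    case (elim x)
    show ?case
    proof (cases "?W x > 0")
      case True
      then have "ennreal ((cmod (?h x))\<^sup>2) \<le> (?e x)\<^sup>2"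
        using elim by (auto simp: ennreal_power[symmetric] intro!: power_mono)
      also have "\<dots> \<le> ?U x * ?V x" using elim True by auto
      finally have "?W x * ennreal ((cmod (?h x))\<^sup>2) \<le> ?W x * ?U x * ?V x"
        by (simp add: mult.assoc mult_left_mono)
      also have "\<dots> \<le> ennreal (C\<^sup>2) * ?V x"
        using elim by (intro mult_right_mono) auto
      finally show ?thesis .
    qed (simp add: not_gr_zero)
  qed
  then have "(\<integral>\<^sup>+x. ?W x * ennreal ((cmod (?h x))\<^sup>2) \<partial>M) \<le> (\<integral>\<^sup>+x. ennreal (C\<^sup>2) * ?V x \<partial>M)"
    by (rule nn_integral_mono_AE)
  also have "\<dots> = ennreal (C\<^sup>2) * (\<integral>\<^sup>+x. ennreal ((cmod (f x))\<^sup>2) \<partial>M)"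
    by (simp add: nn_integral_cmult V_int)
  finally show "(\<integral>\<^sup>+x. ennreal ((cmod (wce_op M F w u f x))\<^sup>2) \<partial>M)
      \<le> ennreal (C\<^sup>2) * (\<integral>\<^sup>+x. ennreal ((cmod (f x))\<^sup>2) \<partial>M)"
    by (simp add: nn_integral_wce_op_sq)
qed

text \<open>For the test function on \<open>B\<close>, \<open>E(uf)\<close> is \<open>U m\<close> on
  \<open>B\<close> and \<open>0\<close> elsewhere, and the integral of \<open>|f|\<^sup>2\<close> is
  that of \<open>U m\<close> over \<open>B\<close>. As \<open>B\<close> is arbitrary, the integral
  bound localises to \<open>W (U m)\<^sup>2 \<le> C\<^sup>2 U m\<close>; cancel \<open>U m\<close>
  and let \<open>m\<close> grow.\<close>

lemma cond_exp_sq_mult_le: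
  assumes [measurable]: "u \<in> borel_measurable M" "w \<in> borel_measurable M"
    and bound: "\<And>f. f \<in> L2 M \<Longrightarrow> (\<integral>\<^sup>+x. ennreal ((cmod (wce_op M F w u f x))\<^sup>2) \<partial>M)
      \<le> ennreal (C\<^sup>2) * (\<integral>\<^sup>+x. ennreal ((cmod (f x))\<^sup>2) \<partial>M)"
  shows "AE x in M. cond_exp_sq M F w x * cond_exp_sq M F u x \<le> ennreal (C\<^sup>2)"
proof -
  let ?W = "cond_exp_sq M F w" and ?U = "cond_exp_sq M F u"
  obtain S :: "nat \<Rightarrow> 'a set" where S [measurable]: "\<And>n. S n \<in> sets F"
    and S_fin: "\<And>n. emeasure M (S n) < \<infinity>" and S_un: "(\<Union>n. S n) = space M"
    using finite_measure_cover by blast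
  define v where "v m x = (if cmod (u x) \<le> real m then (cmod (u x))\<^sup>2 else 0)" for m x
  have [measurable]: "v m \<in> borel_measurable M" for m unfolding v_def by measurable
  have v_nonneg: "0 \<le> v m x" for m x by (simp add: v_def)
  define U where "U m = nn_cond_exp M F (\<lambda>x. ennreal (v m x))" for m
  have [measurable]: "U m \<in> borel_measurable F" for m unfolding U_def by measurable
  have [measurable]: "U m \<in> borel_measurable M" for m unfolding U_def by measurable
  have U_le: "AE x in M. U m x \<le> ennreal ((real m)\<^sup>2)" for m
  proof -
    have "AE x in M. U m x \<le> nn_cond_exp M F (\<lambda>_. ennreal ((real m)\<^sup>2)) x"
      unfolding U_def by (rule nn_cond_exp_mono) (auto simp: v_def intro!: ennreal_leI power_mono)
    moreover have "AE x in M. ennreal ((real m)\<^sup>2) = nn_cond_exp M F (\<lambda>_. ennreal ((real m)\<^sup>2)) x"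
      by (rule nn_cond_exp_F_meas) auto
    ultimately show ?thesis by eventually_elim simp
  qed
  have key: "(\<integral>\<^sup>+x. indicator B x * (?W x * (U m x)\<^sup>2) \<partial>M) \<le> (\<integral>\<^sup>+x. indicator B x * (ennreal (C\<^sup>2) * U m x) \<partial>M)"
    if B [measurable]: "B \<in> sets F" and B_fin: "emeasure M B < \<infinity>" for B m
  proof -
    have [measurable]: "B \<in> sets M" using B by (rule sets_F_imp_M)
    \<comment> \<open>Truncating \<open>cnj u\<close> keeps the test function in \<open>L\<^sup>2\<close> even where \<open>E(|u|\<^sup>2)\<close> is infinite.\<close>
    define f where "f x = (if x \<in> B \<and> cmod (u x) \<le> real m then cnj (u x) else 0)" for x
    have [measurable]: "f \<in> borel_measurable M" unfolding f_def by measurable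
    have f_sq: "(cmod (f x))\<^sup>2 = indicator B x * v m x" for x by (simp add: f_def v_def)
    have uf: "u x * f x = complex_of_real (indicator B x * v m x)" for x
      by (simp add: f_def v_def complex_norm_square[symmetric])
    have f_int: "(\<integral>\<^sup>+x. ennreal ((cmod (f x))\<^sup>2) \<partial>M) = (\<integral>\<^sup>+x. indicator B x * U m x \<partial>M)"
      unfolding f_sq U_def by (subst nn_cond_exp_intg) (auto simp: v_nonneg ennreal_mult ennreal_indicator)
    also have "\<dots> \<le> (\<integral>\<^sup>+x. ennreal ((real m)\<^sup>2) * indicator B x \<partial>M)"
      using U_le[of m] by (intro nn_integral_mono_AE) (auto elim!: eventually_mono simp: indicator_def)
    also have "\<dots> < \<infinity>"
      using B_fin by (simp add: nn_integral_cmult_indicator ennreal_mult_less_top)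
    finally have "f \<in> L2 M" by (simp add: L2_iff)
    have "AE x in M. real_cond_exp M F (\<lambda>x. indicator B x * v m x) x = indicator B x * enn2real (U m x)"
      using real_cond_exp_indicator[of B "v m"] real_cond_exp_eq_enn2real[of "v m"]
      by (auto simp: U_def v_nonneg elim: eventually_elim2)
    \<comment> \<open>This handles the imaginary part, since \<open>u x * f x\<close> is
      real.\<close>
    moreover have "AE x in M. real_cond_exp M F (\<lambda>x. 0) x = 0"
      by (rule real_cond_exp_F_meas) auto
    ultimately have "AE x in M. ennreal ((cmod (complex_cond_exp M F (\<lambda>y. u y * f y) x))\<^sup>2) = indicator B x * (U m x)\<^sup>2"
      using U_le[of m]
    proof eventually_elim
      case (elim x)
      have "U m x < top" using elim(3) by (simp add: le_less_trans)
      have "complex_cond_exp M F (\<lambda>y. u y * f y) x = complex_of_real (indicator B x * enn2real (U m x))"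
        using elim by (simp add: complex_cond_exp_def uf complex_of_real_def)
      then show ?case
        using \<open>U m x < top\<close> by (simp add: norm_mult ennreal_power[symmetric] indicator_def)
    qed
    then have "(\<integral>\<^sup>+x. indicator B x * (?W x * (U m x)\<^sup>2) \<partial>M)
        = (\<integral>\<^sup>+x. ?W x * ennreal ((cmod (complex_cond_exp M F (\<lambda>y. u y * f y) x))\<^sup>2) \<partial>M)"
      by (intro nn_integral_cong_AE) (auto elim!: eventually_mono simp: ac_simps)
    also have "\<dots> \<le> ennreal (C\<^sup>2) * (\<integral>\<^sup>+x. ennreal ((cmod (f x))\<^sup>2) \<partial>M)"
      using bound[OF \<open>f \<in> L2 M\<close>] by (simp add: nn_integral_wce_op_sq)
    also have "\<dots> = (\<integral>\<^sup>+x. indicator B x * (ennreal (C\<^sup>2) * U m x) \<partial>M)"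
      by (simp add: f_int nn_integral_cmult[symmetric] ac_simps)
    finally show ?thesis .
  qed
  have "AE x in M. x \<in> S n \<longrightarrow> ?W x * (U m x)\<^sup>2 \<le> ennreal (C\<^sup>2) * U m x" for n m
  proof -
    \<comment> \<open>\<open>B\<close> collects the violations inside \<open>S n\<close>. Were it
      not null, \<open>nn_integral_less\<close> would give the strict reverse of \<open>key\<close>;
      that rule needs the smaller integral to be finite, which holds because \<open>U m\<close> is
      bounded and \<open>B\<close> has finite measure.\<close>
    define B where "B = {x \<in> S n. ennreal (C\<^sup>2) * U m x < ?W x * (U m x)\<^sup>2}"
    have [measurable]: "B \<in> sets F" unfolding B_def by measurable
    then have [measurable]: "B \<in> sets M" by (rule sets_F_imp_M)
    have "emeasure M B \<le> emeasure M (S n)"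
      by (rule emeasure_mono) (auto simp: B_def intro: sets_F_imp_M)
    then have B_fin: "emeasure M B < \<infinity>" using S_fin[of n] by (rule le_less_trans)
    have le: "AE x in M. indicator B x * (?W x * (U m x)\<^sup>2) \<le> indicator B x * (ennreal (C\<^sup>2) * U m x)"
    proof (rule ccontr)
      assume "\<not> ?thesis"
      then have "(\<integral>\<^sup>+x. indicator B x * (ennreal (C\<^sup>2) * U m x) \<partial>M) < (\<integral>\<^sup>+x. indicator B x * (?W x * (U m x)\<^sup>2) \<partial>M)"
      proof (intro nn_integral_less)
        have "(\<integral>\<^sup>+x. indicator B x * (ennreal (C\<^sup>2) * U m x) \<partial>M)
            \<le> (\<integral>\<^sup>+x. ennreal (C\<^sup>2) * ennreal ((real m)\<^sup>2) * indicator B x \<partial>M)"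
          using U_le[of m] by (intro nn_integral_mono_AE)
            (auto elim!: eventually_mono simp: indicator_def intro!: mult_left_mono)
        also have "\<dots> < \<infinity>"
          using B_fin by (simp add: nn_integral_cmult_indicator ennreal_mult_less_top)
        finally show "(\<integral>\<^sup>+x. indicator B x * (ennreal (C\<^sup>2) * U m x) \<partial>M) \<noteq> \<infinity>" by simp
        show "AE x in M. indicator B x * (ennreal (C\<^sup>2) * U m x) \<le> indicator B x * (?W x * (U m x)\<^sup>2)"
          by (auto simp: B_def indicator_def)
      qed measurable
      with key[OF \<open>B \<in> sets F\<close> B_fin, of m] show False by simp
    qed
    then show ?thesis
    proof eventually_elim
      case (elim x)
      then have "x \<notin> B" by (auto simp: B_def)
      then show ?case by (auto simp: B_def not_less)
    qed
  qed
  then have "AE x in M. \<forall>n m. x \<in> S n \<longrightarrow> ?W x * (U m x)\<^sup>2 \<le> ennreal (C\<^sup>2) * U m x"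
    unfolding AE_all_countable by blast
  moreover have "AE x in M. \<forall>m. U m x \<le> ennreal ((real m)\<^sup>2)"
    using U_le by (simp add: AE_all_countable)
  moreover have "AE x in M. (SUP m. U m x) = ?U x"
  proof -
    have "(SUP m. ennreal (v m x)) = ennreal ((cmod (u x))\<^sup>2)" for x
    proof (rule antisym)
      show "(SUP m. ennreal (v m x)) \<le> ennreal ((cmod (u x))\<^sup>2)"
        by (rule SUP_least) (simp add: v_def)
      obtain m where "cmod (u x) \<le> real m" using real_arch_simple by blast
      then show "ennreal ((cmod (u x))\<^sup>2) \<le> (SUP m. ennreal (v m x))"
        by (intro SUP_upper2[of m]) (auto simp: v_def)
    qed
    moreover have "incseq (\<lambda>m. ennreal (v m x))" for x
      by (intro incseq_SucI ennreal_leI) (auto simp: v_def)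
    ultimately show ?thesis
      using nn_cond_exp_SUP[of "\<lambda>m x. ennreal (v m x)"] by (simp add: U_def cond_exp_sq_def)
  qed
  ultimately show ?thesis
  proof (rule AE_mp[OF AE_conjI[OF _ AE_conjI]], intro AE_I2 impI)
    fix x assume "x \<in> space M"
      and *: "(\<forall>n m. x \<in> S n \<longrightarrow> ?W x * (U m x)\<^sup>2 \<le> ennreal (C\<^sup>2) * U m x) \<and>
        (\<forall>m. U m x \<le> ennreal ((real m)\<^sup>2)) \<and> (SUP m. U m x) = ?U x"
    obtain n where n: "x \<in> S n" using S_un \<open>x \<in> space M\<close> by blast
    have "?W x * U m x \<le> ennreal (C\<^sup>2)" for m
    proof (cases "U m x = 0")
      case False
      \<comment> \<open>Cancelling a factor in \<open>ennreal\<close> requires it to be neither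
        \<open>0\<close> nor infinite; the truncation guarantees the latter.\<close>
      have "U m x < top"
        using * by (meson ennreal_less_top le_less_trans)
      moreover have "U m x * (?W x * U m x) \<le> U m x * ennreal (C\<^sup>2)"
      proof -
        have "?W x * (U m x)\<^sup>2 \<le> ennreal (C\<^sup>2) * U m x" using * n by blast
        then show ?thesis by (simp add: power2_eq_square ac_simps)
      qed
      ultimately show ?thesis
        using False by (simp add: ennreal_mult_le_mult_iff)
    qed simp
    then have "(SUP m. ?W x * U m x) \<le> ennreal (C\<^sup>2)" by (rule SUP_least)
    then show "?W x * ?U x \<le> ennreal (C\<^sup>2)"
      using * by (metis SUP_mult_left_ennreal)
  qed
qed

section \<open>The essential supremum as the least bound of the operator\<close>

text \<open>The set where the product exceeds \<open>C\<close> lies in \<open>F\<close>, so being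
  null means the same for \<open>M\<close> and for the restricted measure.\<close>

lemma esssup_ennsqrt_le_iff:
  assumes "0 \<le> C"
  shows "esssup (restr_to_subalg M F) (\<lambda>x. ennsqrt (cond_exp_sq M F w x) * ennsqrt (cond_exp_sq M F u x)) \<le> ennreal C
    \<longleftrightarrow> (AE x in M. cond_exp_sq M F w x * cond_exp_sq M F u x \<le> ennreal (C\<^sup>2))"
    (is "esssup ?N ?h \<le> _ \<longleftrightarrow> _")
proof -
  have h [measurable]: "?h \<in> borel_measurable F" by measurable
  have "esssup ?N ?h \<le> ennreal C \<longleftrightarrow> (AE x in ?N. ?h x \<le> ennreal C)"
    using esssup_AE[of ?h ?N] measurable_in_subalg[OF subalg h]
    by (auto intro: esssup_I elim!: eventually_mono)
  also have "\<dots> \<longleftrightarrow> (AE x in M. ?h x \<le> ennreal C)"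
    by (auto intro: AE_restr_to_subalg[OF subalg] AE_restr_to_subalg2[OF subalg])
  finally show ?thesis
    using assms by (simp add: ennsqrt_mult_le_iff)
qed

end

theorem theorem2p1:
  fixes M F :: "'a measure" and u w :: "'a \<Rightarrow> complex"
  assumes "complete_measure M"
    and "sigma_finite_measure M"
    and "subalgebra M F"
    and "sigma_finite_measure (restr_to_subalg M F)"
    and "u \<in> cond_exp_dom M F"
    and "w \<in> cond_exp_dom M F"
  shows "(wce_bounded M F w u \<longleftrightarrow>
            (\<lambda>x. ennsqrt (cond_exp_sq M F w x) * ennsqrt (cond_exp_sq M F u x))
              \<in> Linfty (restr_to_subalg M F)) \<and>
         (wce_bounded M F w u \<longrightarrow>
            ennreal (wce_norm M F w u) =
              Linfty_norm (restr_to_subalg M F)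
                (\<lambda>x. ennsqrt (cond_exp_sq M F w x) * ennsqrt (cond_exp_sq M F u x)))"
proof -
  interpret sigma_finite_subalgebra M F
    using assms(3,4) by (rule sigma_finite_subalgebra.intro)
  have [measurable]: "u \<in> borel_measurable M" "w \<in> borel_measurable M"
    using assms(5,6) by (auto simp: cond_exp_dom_def)
  let ?N = "restr_to_subalg M F"
  let ?h = "\<lambda>x. ennsqrt (cond_exp_sq M F w x) * ennsqrt (cond_exp_sq M F u x)"
  have meas: "?h \<in> borel_measurable ?N"
    by (rule measurable_in_subalg[OF subalg]) measurable
  \<comment> \<open>\<open>wce_bounded\<close> is assumed besides \<open>wce_bound\<close> because
    it puts \<open>wce_op M F w u f\<close> into \<open>L2 M\<close>; the integral of a
    non-integrable function defaults to \<open>0\<close>, so \<open>L2_norm\<close> alone would say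
    nothing there. Together with \<open>bdd\<close> this identifies the bounds of a bounded operator
    as the nonnegative reals above the essential supremum.\<close>
  have le: "esssup ?N ?h \<le> ennreal C" if "wce_bounded M F w u" "wce_bound M F w u C" for C
  proof -
    have "0 \<le> C" using that(2) by (simp add: wce_bound_def)
    have "AE x in M. cond_exp_sq M F w x * cond_exp_sq M F u x \<le> ennreal (C\<^sup>2)"
    proof (rule cond_exp_sq_mult_le)
      fix f assume "f \<in> L2 M"
      then show "(\<integral>\<^sup>+x. ennreal ((cmod (wce_op M F w u f x))\<^sup>2) \<partial>M)
          \<le> ennreal (C\<^sup>2) * (\<integral>\<^sup>+x. ennreal ((cmod (f x))\<^sup>2) \<partial>M)"
        using that by (subst L2_norm_le_iff[symmetric]) (auto simp: wce_bounded_def wce_bound_def)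
    qed measurable
    then show ?thesis by (simp add: esssup_ennsqrt_le_iff \<open>0 \<le> C\<close>)
  qed
  have bdd: "wce_bounded M F w u \<and> wce_bound M F w u C" if "0 \<le> C" "esssup ?N ?h \<le> ennreal C" for C
  proof -
    have WU: "AE x in M. cond_exp_sq M F w x * cond_exp_sq M F u x \<le> ennreal (C\<^sup>2)"
      using that by (simp add: esssup_ennsqrt_le_iff)
    note wce = wce_op_bound[OF \<open>u \<in> borel_measurable M\<close> \<open>w \<in> borel_measurable M\<close> \<open>0 \<le> C\<close> WU]
    have Tf: "wce_op M F w u f \<in> L2 M" if "f \<in> L2 M" for f
    proof -
      have "ennreal (C\<^sup>2) * (\<integral>\<^sup>+x. ennreal ((cmod (f x))\<^sup>2) \<partial>M) < \<infinity>"
        using that by (simp add: L2_iff ennreal_mult_less_top)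
      with wce(2)[OF that] show ?thesis
        unfolding L2_iff by (auto intro: le_less_trans)
    qed
    have "wce_bound M F w u C"
      using wce(2) Tf \<open>0 \<le> C\<close> by (auto simp: wce_bound_def L2_norm_le_iff)
    then show ?thesis
      using wce(1) Tf by (auto simp: wce_bounded_def)
  qed
  have iff: "wce_bounded M F w u \<longleftrightarrow> ?h \<in> Linfty ?N"
  proof
    assume b: "wce_bounded M F w u"
    then obtain C where "wce_bound M F w u C" by (auto simp: wce_bounded_def)
    from le[OF b this] show "?h \<in> Linfty ?N"
      using meas by (auto simp: Linfty_def intro: le_less_trans)
  next
    assume "?h \<in> Linfty ?N"
    \<comment> \<open>A finite essential supremum is itself an admissible constant.\<close>
    then have "esssup ?N ?h \<le> ennreal (enn2real (esssup ?N ?h))"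
      by (simp add: Linfty_def)
    from bdd[OF enn2real_nonneg this] show "wce_bounded M F w u" ..
  qed
  moreover have "ennreal (wce_norm M F w u) = esssup ?N ?h" if b: "wce_bounded M F w u"
  proof -
    obtain k where k: "esssup ?N ?h = ennreal k" "0 \<le> k"
      using b iff by (cases "esssup ?N ?h") (auto simp: Linfty_def)
    have "wce_norm M F w u = k"
      unfolding wce_norm_def
    proof (rule Least_equality)
      show "wce_bound M F w u k" using bdd[of k] k by simp
    next
      fix C assume C: "wce_bound M F w u C"
      then have "0 \<le> C" by (simp add: wce_bound_def)
      with le[OF b C] k show "k \<le> C" by simp
    qed
    with k show ?thesis by simp
  qed
  ultimately show ?thesis by (simp add: Linfty_norm_def)
qed

end
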